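(* Let $\mathbb A$ be an algebra on $\mathbb R^3$ with unit $e$. If $F$ is an $\mathbb A$-algebrizable vector field defined on an open set $\Omega\subset\mathbb R^3$, then the Riemannian metric $g=\frac{1}{\|e\|^2}H^*\lambda$ makes $F$ geodesible on $\Omega(F,\mathbb A^* )$; that is, the integral curves of $F$ in $\Omega(F,\mathbb A^* )$ are unit-speed geodesics of $g$.
   Context: An algebra $\mathbb A$ on $\mathbb R^3$ is the linear space $\mathbb R^3$ endowed with a bilinear, associative, commutative product with unit $e$. $\mathbb A^*$ is the set of elements having a multiplicative inverse; the inverse of $a$ is written $\frac{e}{a}$. A vector field $F:\Omega\subset\mathbb R^3\to\mathbb R^3$, $\Omega$ open, is $\mathbb A$-algebrizable if there is a function $F':\Omega\to\mathbb R^3$ with $\lim_{\xi\to0}|F(w+\xi)-F(w)-F'(w)\xi|/|\xi|=0$ for all $w\in\Omega$, where $F'(w)\xi$ is the product in $\mathbb A$. The regular domain is $\Omega(F,\mathbb A^* )=F^{-1}(\mathbb A^* )$. $H$ is the (possibly multivalued) function on $\Omega(F,\mathbb A^* )$ given by $H(w)=\int_\gamma\frac{e}{F}d\xi:=\int_0^a\frac{e}{F(\gamma(t))}\dot\gamma(t)\,dt$ (product in $\mathbb A$), where $\gamma:[0,a]\to\Omega(F,\mathbb A^* )$ is a (piecewise continuously) differentiable curve from a base point fixed in the connected component of $w$ to $w$. Locally $H$ has single-valued branches differing by constants, so $H^*\lambda$ is well defined, where $\lambda_{ij}=\delta_{ij}$ is the natural Riemannian metric of $\mathbb R^3$; $\|e\|$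 is the Euclidean norm of $e$. A vector field $F$ is geodesible on an open set if there is a Riemannian metric on it for which the integral curves of $F$ are unitary (unit-speed) geodesics. Since $F$ is only assumed differentiable, metrics are understood with coefficients of the corresponding (differentiable) regularity. *)

theory Defs
  imports "HOL-Analysis.Analysis"
begin

definition algebra_on_R3 :: "(real^3 \<Rightarrow> real^3 \<Rightarrow> real^3) \<Rightarrow> real^3 \<Rightarrow> bool" where
  "algebra_on_R3 m e \<longleftrightarrow>
     bilinear m \<and>
     (\<forall>a b c. m (m a b) c = m a (m b c)) \<and>
     (\<forall>a b. m a b = m b a) \<and>
     (\<forall>a. m e a = a)"

definition alg_units :: "(real^3 \<Rightarrow> real^3 \<Rightarrow> real^3) \<Rightarrow> real^3 \<Rightarrow> (real^3) set" where
  "alg_units m e = {a. \<exists>b. m a b = e}"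

definition alg_inv :: "(real^3 \<Rightarrow> real^3 \<Rightarrow> real^3) \<Rightarrow> real^3 \<Rightarrow> real^3 \<Rightarrow> real^3" where
  "alg_inv m e a = (THE b. m a b = e)"

definition algebrizable ::
  "(real^3 \<Rightarrow> real^3 \<Rightarrow> real^3) \<Rightarrow> (real^3) set \<Rightarrow> (real^3 \<Rightarrow> real^3) \<Rightarrow> bool" where
  "algebrizable m \<Omega> F \<longleftrightarrow> (\<exists>F'. \<forall>w\<in>\<Omega>. (F has_derivative (\<lambda>\<xi>. m (F' w) \<xi>)) (at w))"

definition regular_domain ::
  "(real^3 \<Rightarrow> real^3 \<Rightarrow> real^3) \<Rightarrow> real^3 \<Rightarrow> (real^3) set \<Rightarrow> (real^3 \<Rightarrow> real^3) \<Rightarrow> (real^3) set" where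
  "regular_domain m e \<Omega> F = {w \<in> \<Omega>. F w \<in> alg_units m e}"

definition curve_in :: "(real^3) set \<Rightarrow> real \<Rightarrow> (real \<Rightarrow> real^3) \<Rightarrow> bool" where
  "curve_in U a \<gamma> \<longleftrightarrow> 0 \<le> a \<and> \<gamma> piecewise_C1_differentiable_on {0..a} \<and> \<gamma> ` {0..a} \<subseteq> U"

definition inv_line_integral ::
  "(real^3 \<Rightarrow> real^3 \<Rightarrow> real^3) \<Rightarrow> real^3 \<Rightarrow> (real^3 \<Rightarrow> real^3) \<Rightarrow> real \<Rightarrow> (real \<Rightarrow> real^3) \<Rightarrow> real^3" where
  "inv_line_integral m e F a \<gamma> =
     integral {0..a}
       (\<lambda>t. m (alg_inv m e (F (\<gamma> t))) (vector_derivative \<gamma> (at t within {0..a})))"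

definition base_points :: "(real^3) set \<Rightarrow> (real^3 \<Rightarrow> real^3) \<Rightarrow> bool" where
  "base_points D b \<longleftrightarrow>
     (\<forall>w\<in>D. b w \<in> connected_component_set D w) \<and>
     (\<forall>w w'. connected_component D w w' \<longrightarrow> b w = b w')"

definition H_values ::
  "(real^3 \<Rightarrow> real^3 \<Rightarrow> real^3) \<Rightarrow> real^3 \<Rightarrow> (real^3) set \<Rightarrow> (real^3 \<Rightarrow> real^3) \<Rightarrow>
   (real^3 \<Rightarrow> real^3) \<Rightarrow> real^3 \<Rightarrow> (real^3) set" where
  "H_values m e \<Omega> F b w =
     {inv_line_integral m e F a \<gamma> | a \<gamma>.
        curve_in (regular_domain m e \<Omega> F) a \<gamma> \<and> \<gamma> 0 = b w \<and> \<gamma> a = w}"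

text \<open>
  A single-valued branch \<open>h\<close> on \<open>U\<close> selects values of \<open>H\<close>, and does so coherently: following
  a curve inside \<open>U\<close> continues the defining curve, and so adds the integral along it.
\<close>

definition H_branch ::
  "(real^3 \<Rightarrow> real^3 \<Rightarrow> real^3) \<Rightarrow> real^3 \<Rightarrow> (real^3) set \<Rightarrow> (real^3 \<Rightarrow> real^3) \<Rightarrow>
   (real^3 \<Rightarrow> real^3) \<Rightarrow> (real^3) set \<Rightarrow> (real^3 \<Rightarrow> real^3) \<Rightarrow> bool" where
  "H_branch m e \<Omega> F b U h \<longleftrightarrow>
     open U \<and> U \<subseteq> regular_domain m e \<Omega> F \<and>
     (\<forall>w\<in>U. h w \<in> H_values m e \<Omega> F b w) \<and>
     (\<forall>a \<gamma>. curve_in U a \<gamma> \<longrightarrow> h (\<gamma> a) = h (\<gamma> 0) + inv_line_integral m e F a \<gamma>)"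

type_synonym metric_field = "real^3 \<Rightarrow> real^3 \<Rightarrow> real^3 \<Rightarrow> real"

definition coeff :: "metric_field \<Rightarrow> 3 \<Rightarrow> 3 \<Rightarrow> real^3 \<Rightarrow> real" where
  "coeff g i j w = g w (axis i 1) (axis j 1)"

definition riemannian_metric_on :: "(real^3) set \<Rightarrow> metric_field \<Rightarrow> bool" where
  "riemannian_metric_on U g \<longleftrightarrow>
     open U \<and>
     (\<forall>w\<in>U. bilinear (g w) \<and> (\<forall>u v. g w u v = g w v u) \<and> (\<forall>u. u \<noteq> 0 \<longrightarrow> g w u u > 0)) \<and>
     (\<forall>i j. coeff g i j differentiable_on U)"

definition euclidean_metric :: metric_field where
  "euclidean_metric w u v = u \<bullet> v"

definition pullback :: "(real^3 \<Rightarrow> real^3) \<Rightarrow> metric_field \<Rightarrow> metric_field" where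
  "pullback h g w u v = g (h w) (frechet_derivative h (at w) u) (frechet_derivative h (at w) v)"

text \<open>
  The pullback \<open>H\<^sup>*\<lambda>\<close> of the Euclidean metric: its value at \<open>w\<close> is the common value of the
  pullbacks by all the branches of \<open>H\<close> defined near \<open>w\<close>.
\<close>

definition H_pullback_metric ::
  "(real^3 \<Rightarrow> real^3 \<Rightarrow> real^3) \<Rightarrow> real^3 \<Rightarrow> (real^3) set \<Rightarrow> (real^3 \<Rightarrow> real^3) \<Rightarrow>
   (real^3 \<Rightarrow> real^3) \<Rightarrow> metric_field" where
  "H_pullback_metric m e \<Omega> F b w u v =
     (THE r. \<exists>U h. w \<in> U \<and> H_branch m e \<Omega> F b U h \<and> r = pullback h euclidean_metric w u v)"

definition partial_coeff :: "metric_field \<Rightarrow> 3 \<Rightarrow> 3 \<Rightarrow> 3 \<Rightarrow> real^3 \<Rightarrow> real" where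
  "partial_coeff g l i j w = frechet_derivative (coeff g i j) (at w) (axis l 1)"

text \<open>Christoffel symbols of the second kind, \<open>k\<close> being the upper index.\<close>

definition christoffel :: "metric_field \<Rightarrow> 3 \<Rightarrow> 3 \<Rightarrow> 3 \<Rightarrow> real^3 \<Rightarrow> real" where
  "christoffel g k i j w =
     (1/2) * (\<Sum>l\<in>UNIV. matrix_inv (\<chi> p q. coeff g p q w) $ k $ l *
        (partial_coeff g i j l w + partial_coeff g j i l w - partial_coeff g l i j w))"

definition unit_speed_geodesic :: "metric_field \<Rightarrow> real set \<Rightarrow> (real \<Rightarrow> real^3) \<Rightarrow> bool" where
  "unit_speed_geodesic g I \<gamma> \<longleftrightarrow>
     (\<exists>v a. \<forall>t\<in>I.
        (\<gamma> has_vector_derivative v t) (at t) \<and>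
        (v has_vector_derivative a t) (at t) \<and>
        (\<forall>k. a t $ k +
           (\<Sum>i\<in>UNIV. \<Sum>j\<in>UNIV. christoffel g k i j (\<gamma> t) * v t $ i * v t $ j) = 0) \<and>
        g (\<gamma> t) (v t) (v t) = 1)"

definition integral_curve ::
  "(real^3 \<Rightarrow> real^3) \<Rightarrow> (real^3) set \<Rightarrow> real set \<Rightarrow> (real \<Rightarrow> real^3) \<Rightarrow> bool" where
  "integral_curve F U I \<gamma> \<longleftrightarrow>
     open I \<and> is_interval I \<and>
     (\<forall>t\<in>I. \<gamma> t \<in> U \<and> (\<gamma> has_vector_derivative F (\<gamma> t)) (at t))"

definition makes_geodesible ::
  "metric_field \<Rightarrow> (real^3 \<Rightarrow> real^3) \<Rightarrow> (real^3) set \<Rightarrow> bool" where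
  "makes_geodesible g F U \<longleftrightarrow>
     riemannian_metric_on U g \<and>
     (\<forall>I \<gamma>. integral_curve F U I \<gamma> \<longrightarrow> unit_speed_geodesic g I \<gamma>)"

end

theory Submission
  imports Defs
begin

text \<open>
  Multiplication by the algebra-valued function \<open>e/F\<close> is a one-form \<open>\<xi> \<mapsto> (e/F) \<xi>\<close> on the regular domain,
  and \<open>H\<close> is its multivalued primitive. A branch of \<open>H\<close> has derivative \<open>\<xi> \<mapsto> (e/F) \<xi>\<close> and therefore sends
  the vector field \<open>F\<close> to the constant field \<open>(e/F) F = e\<close>. So it takes the integral curves of \<open>F\<close> to
  straight lines traversed with velocity \<open>e\<close>, which are geodesics of the Euclidean metric of constant
  speed \<open>\<bar>e\<bar>\<close>; pulling that metric back and dividing it by \<open>\<bar>e\<bar>\<^sup>2\<close> gives unit-speed geodesics.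

  Two points need work. One is that \<open>H\<close> has single-valued branches near every point. The form is
  differentiable because inversion in the algebra is (\<open>alg_inv_has_derivative\<close>), and its derivative is
  symmetric because the product is commutative and associative; but \<open>F'\<close> need not be
  continuous, so the classical Poincare lemma does not apply. As in complex analysis, Goursat's
  subdivision of triangles replaces it (\<open>triangle_integral_eq_0\<close>, \<open>closed_form_has_primitive\<close>). Branches are then
  obtained by continuing a fixed curve from the base point along segments (\<open>branch_exists\<close>).

  The other is that the geodesic equation is stated through Christoffel symbols. The metric is
  \<open>g(u, v) = \<langle>(e/F) u, (e/F) v\<rangle>/\<bar>e\<bar>\<^sup>2\<close> (\<open>H_pullback_metric_eq\<close>), whose coefficients are differentiable although a
  branch of \<open>H\<close> need not be twice continuously differentiable, so the symbols are computed from
  this formula. They are the components of \<open>F (e/F)' e\<^sub>i e\<^sub>j\<close> (\<open>christoffel_g\<close>), and the geodesic equation for an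
  integral curve becomes \<open>F' F + F (- F'/F\<^sup>2) F F = 0\<close>.
\<close>

section \<open>Integration of one-forms along segments\<close>

text \<open>
  A one-form on a normed space \<open>'a\<close> is a map \<open>\<omega>\<close> into the bounded operators on \<open>'a\<close>. The operator
  norm makes it meaningful to call \<open>\<omega>\<close> continuous or differentiable.
\<close>

definition segment_integral ::
  "('a::real_normed_vector \<Rightarrow> 'a \<Rightarrow>\<^sub>L 'b::real_normed_vector) \<Rightarrow> 'a \<Rightarrow> 'a \<Rightarrow> 'b" where
  "segment_integral \<omega> x y = integral {0..1} (\<lambda>t. \<omega> (linepath x y t) (y - x))"

lemma has_integral_segment_integral:
  fixes \<omega> :: "'a::real_normed_vector \<Rightarrow> 'a \<Rightarrow>\<^sub>L 'b::banach"
  assumes "continuous_on (closed_segment x y) \<omega>"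
  shows "((\<lambda>t. \<omega> (linepath x y t) (y - x)) has_integral segment_integral \<omega> x y) {0..1}"
proof -
  have "continuous_on {0..1} (\<omega> \<circ> linepath x y)"
    using assms by (intro continuous_on_compose) (auto simp flip: path_image_def simp: path_image_linepath)
  then have "continuous_on {0..1} (\<lambda>t. \<omega> (linepath x y t) (y - x))"
    by (auto simp: o_def intro!: continuous_intros)
  then show ?thesis
    unfolding segment_integral_def by (simp add: integrable_continuous_real integrable_integral)
qed

text \<open>
  Additivity under subdivision and the effect of reversal both say that the integrals over
  the oriented subsegments of one segment are increments of a single function, namely of an
  antiderivative of the integrand in the parameter of the segment.
\<close>

lemma segment_integral_antiderivative:
  fixes \<omega> :: "'a::real_normed_vector \<Rightarrow> 'a \<Rightarrow>\<^sub>L 'b::banach"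
  assumes cont: "continuous_on (closed_segment x y) \<omega>"
  obtains G where "\<And>s s'. \<lbrakk>s \<in> {0..1}; s' \<in> {0..1}\<rbrakk>
    \<Longrightarrow> segment_integral \<omega> (linepath x y s) (linepath x y s') = G s' - G s"
proof
  define g where "g t = \<omega> (linepath x y t) (y - x)" for t
  define G where "G t = integral {0..t} g" for t
  have "continuous_on {0..1} (\<omega> \<circ> linepath x y)"
    using cont by (intro continuous_on_compose) (auto simp flip: path_image_def simp: path_image_linepath)
  then have "continuous_on {0..1} g"
    by (auto simp: o_def g_def intro!: continuous_intros)
  then have G: "(G has_vector_derivative g t) (at t within {0..1})" if "t \<in> {0..1}" for t
    unfolding G_def using that by (rule integral_has_vector_derivative)
  fix s s' :: real assume s: "s \<in> {0..1}" "s' \<in> {0..1}"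
  let ?x = "linepath x y s" and ?y = "linepath x y s'"
  have sub: "linepath s s' ` {0..1} \<subseteq> {0..1}"
    using s by (metis closed_segment_subset convex_real_interval(5) linepath_image_01)
  have point: "linepath ?x ?y t = linepath x y (linepath s s' t)" for t
    by (simp add: linepath_def algebra_simps)
  have "?y - ?x = (s' - s) *\<^sub>R (y - x)"
    by (simp add: linepath_def algebra_simps)
  then have integrand: "\<omega> (linepath ?x ?y t) (?y - ?x) = (s' - s) *\<^sub>R g (linepath s s' t)" for t
    by (simp add: point g_def blinfun.scaleR_right)
  have "((\<lambda>t. (s' - s) *\<^sub>R g (linepath s s' t)) has_integral
      (G \<circ> linepath s s') 1 - (G \<circ> linepath s s') 0) {0..1}"
  proof (rule fundamental_theorem_of_calculus)
    fix t :: real assume t: "t \<in> {0..1}"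
    have "(G has_vector_derivative g (linepath s s' t)) (at (linepath s s' t) within linepath s s' ` {0..1})"
      using G sub t by (meson has_vector_derivative_within_subset image_subset_iff)
    then show "(G \<circ> linepath s s' has_vector_derivative (s' - s) *\<^sub>R g (linepath s s' t)) (at t within {0..1})"
      using vector_diff_chain_within [OF has_vector_derivative_linepath_within] by blast
  qed simp
  then have "integral {0..1} (\<lambda>t. (s' - s) *\<^sub>R g (linepath s s' t))
      = (G \<circ> linepath s s') 1 - (G \<circ> linepath s s') 0"
    by (rule integral_unique)
  then show "segment_integral \<omega> ?x ?y = G s' - G s"
    unfolding segment_integral_def integrand by (simp only: o_def linepath_0' linepath_1')
qed

lemma segment_integral_reverse:
  fixes \<omega> :: "'a::real_normed_vector \<Rightarrow> 'a \<Rightarrow>\<^sub>L 'b::banach"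
  assumes "continuous_on (closed_segment x y) \<omega>"
  shows "segment_integral \<omega> y x = - segment_integral \<omega> x y"
proof -
  obtain G where G: "\<And>s s'. \<lbrakk>s \<in> {0..1}; s' \<in> {0..1}\<rbrakk>
      \<Longrightarrow> segment_integral \<omega> (linepath x y s) (linepath x y s') = G s' - G s"
    using segment_integral_antiderivative [OF assms] by blast
  show ?thesis
    using G [of 0 1] G [of 1 0] by (simp add: linepath_def)
qed

lemma segment_integral_midpoint:
  fixes \<omega> :: "'a::real_normed_vector \<Rightarrow> 'a \<Rightarrow>\<^sub>L 'b::banach"
  assumes "continuous_on (closed_segment x y) \<omega>"
  shows "segment_integral \<omega> x y
    = segment_integral \<omega> x (midpoint x y) + segment_integral \<omega> (midpoint x y) y"
proof -
  obtain G where G: "\<And>s s'. \<lbrakk>s \<in> {0..1}; s' \<in> {0..1}\<rbrakk>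
      \<Longrightarrow> segment_integral \<omega> (linepath x y s) (linepath x y s') = G s' - G s"
    using segment_integral_antiderivative [OF assms] by blast
  have "linepath x y (1/2) = midpoint x y"
    by (simp add: linepath_def midpoint_def scaleR_add_right inverse_eq_divide)
  then show ?thesis
    using G [of 0 "1/2"] G [of "1/2" 1] G [of 0 1] by (simp add: linepath_def)
qed

lemma segment_integral_diff:
  fixes \<omega> \<eta> :: "'a::real_normed_vector \<Rightarrow> 'a \<Rightarrow>\<^sub>L 'b::banach"
  assumes "continuous_on (closed_segment x y) \<omega>" "continuous_on (closed_segment x y) \<eta>"
  shows "segment_integral (\<lambda>z. \<omega> z - \<eta> z) x y = segment_integral \<omega> x y - segment_integral \<eta> x y"
proof -
  have "((\<lambda>t. (\<omega> (linepath x y t) - \<eta> (linepath x y t)) (y - x)) has_integral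
      segment_integral \<omega> x y - segment_integral \<eta> x y) {0..1}"
    using has_integral_diff [OF has_integral_segment_integral [OF assms(1)]
        has_integral_segment_integral [OF assms(2)]]
    by (simp add: blinfun.diff_left)
  then show ?thesis
    unfolding segment_integral_def by (rule integral_unique)
qed

lemma norm_segment_integral_le:
  fixes \<omega> :: "'a::real_normed_vector \<Rightarrow> 'a \<Rightarrow>\<^sub>L 'b::banach"
  assumes "continuous_on (closed_segment x y) \<omega>"
    and "\<And>z. z \<in> closed_segment x y \<Longrightarrow> norm (\<omega> z) \<le> B"
  shows "norm (segment_integral \<omega> x y) \<le> B * dist x y"
proof -
  have "0 \<le> B"
    using order_trans [OF norm_ge_zero assms(2) [of x]] by simp
  have "norm (\<omega> (linepath x y t) (y - x)) \<le> B * norm (y - x)" if "t \<in> {0..1}" for t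
  proof -
    have "linepath x y t \<in> closed_segment x y"
      using that by (simp add: linepath_in_path)
    then show ?thesis
      by (meson assms(2) mult_right_mono norm_blinfun norm_ge_zero order_trans)
  qed
  then show ?thesis
    using has_integral_bound_real [OF _ finite.emptyI has_integral_segment_integral [OF assms(1)],
        of "B * norm (y - x)"] \<open>0 \<le> B\<close>
    by (simp add: dist_norm norm_minus_commute)
qed

lemma segment_integral_of_derivative:
  fixes h :: "'a::real_normed_vector \<Rightarrow> 'b::banach" and \<omega> :: "'a \<Rightarrow> 'a \<Rightarrow>\<^sub>L 'b"
  assumes "\<And>z. z \<in> closed_segment x y \<Longrightarrow> (h has_derivative \<omega> z) (at z)"
  shows "segment_integral \<omega> x y = h y - h x"
proof -
  have "((\<lambda>t. \<omega> (linepath x y t) (y - x)) has_integral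
      h (linepath x y 1) - h (linepath x y 0)) {0..1}"
  proof (rule fundamental_theorem_of_calculus)
    fix t :: real assume "t \<in> {0..1}"
    then have "linepath x y t \<in> closed_segment x y"
      by (simp add: linepath_in_path)
    then have "(h has_derivative \<omega> (linepath x y t)) (at (linepath x y t))"
      by (rule assms)
    then have "(h \<circ> linepath x y has_vector_derivative \<omega> (linepath x y t) (y - x)) (at t within {0..1})"
      using vector_derivative_diff_chain_within [OF has_vector_derivative_linepath_within]
        has_derivative_at_withinI by blast
    then show "((\<lambda>t. h (linepath x y t)) has_vector_derivative \<omega> (linepath x y t) (y - x)) (at t within {0..1})"
      by (simp add: o_def)
  qed simp
  then show ?thesis
    by (simp add: segment_integral_def integral_unique linepath_def)
qed

section \<open>Goursat's theorem for closed one-forms\<close>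

definition triangle_integral ::
  "('a::real_normed_vector \<Rightarrow> 'a \<Rightarrow>\<^sub>L 'b::real_normed_vector) \<Rightarrow> 'a \<Rightarrow> 'a \<Rightarrow> 'a \<Rightarrow> 'b" where
  "triangle_integral \<omega> a b c =
     segment_integral \<omega> a b + segment_integral \<omega> b c + segment_integral \<omega> c a"

definition perimeter :: "'a::real_normed_vector \<Rightarrow> 'a \<Rightarrow> 'a \<Rightarrow> real" where
  "perimeter a b c = dist a b + dist b c + dist c a"

lemma dist_le_perimeter:
  assumes "x \<in> convex hull {a, b, c}" "y \<in> convex hull {a, b, c}"
  shows "dist x y \<le> perimeter a b c"
proof -
  have vertex: "dist v y \<le> perimeter a b c" if "v \<in> {a, b, c}" "y \<in> convex hull {a, b, c}" for v y
  proof -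
    have "{a, b, c} \<subseteq> cball v (perimeter a b c)"
      using that(1) by (auto simp: perimeter_def dist_commute)
    then have "convex hull {a, b, c} \<subseteq> cball v (perimeter a b c)"
      by (rule hull_minimal) simp
    then show ?thesis using that(2) by auto
  qed
  have "{a, b, c} \<subseteq> cball y (perimeter a b c)"
    using vertex [OF _ assms(2)] by (auto simp: dist_commute)
  then have "convex hull {a, b, c} \<subseteq> cball y (perimeter a b c)"
    by (rule hull_minimal) simp
  then show ?thesis using assms(1) by (auto simp: dist_commute)
qed

text \<open>
  Near \<open>x\<close> the form is its affine part plus an error of size \<open>\<epsilon> \<bar>z - x\<bar>\<close>. The symmetry of the derivative
  is what makes the affine part exact, so that it contributes nothing to the integral around
  a closed curve; the error contributes at most \<open>\<epsilon>\<close> times the diameter times the perimeter, and the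
  diameter is at most the perimeter.
\<close>

lemma triangle_integral_small:
  fixes \<omega> :: "'a::real_normed_vector \<Rightarrow> 'a \<Rightarrow>\<^sub>L 'b::banach" and \<omega>' :: "'a \<Rightarrow> 'a \<Rightarrow>\<^sub>L 'b"
  assumes deriv: "(\<omega> has_derivative \<omega>') (at x)"
    and sym: "\<And>\<xi> \<eta>. \<omega>' \<xi> \<eta> = \<omega>' \<eta> \<xi>"
    and "\<epsilon> > 0"
  obtains d where "d > 0"
    "\<And>a b c. \<lbrakk>x \<in> convex hull {a, b, c}; perimeter a b c < d;
        continuous_on (convex hull {a, b, c}) \<omega>\<rbrakk>
      \<Longrightarrow> norm (triangle_integral \<omega> a b c) \<le> \<epsilon> * (perimeter a b c)\<^sup>2"
proof -
  obtain d where "d > 0" and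
    d: "\<And>z. norm (z - x) < d \<Longrightarrow> norm (\<omega> z - \<omega> x - \<omega>' (z - x)) \<le> \<epsilon> * norm (z - x)"
    using deriv \<open>\<epsilon> > 0\<close> unfolding has_derivative_at_alt by blast
  define \<alpha> where "\<alpha> z = \<omega> x + \<omega>' (z - x)" for z
  have lin: "bounded_linear \<omega>'"
    using deriv by (rule has_derivative_bounded_linear)
  note [derivative_intros] = bounded_linear.has_derivative [OF lin]
  note [continuous_intros] = bounded_linear.continuous_on [OF lin]
  have \<alpha>_cont: "continuous_on S \<alpha>" for S
    unfolding \<alpha>_def by (intro continuous_intros)
  define p where "p z = \<omega> x z + (1/2) *\<^sub>R \<omega>' (z - x) (z - x)" for z
  \<comment> \<open>an antiderivative of the affine part, correct because \<open>\<omega>'\<close> is symmetric\<close>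
  have "(p has_derivative (\<lambda>\<xi>. \<omega> x \<xi> + (1/2) *\<^sub>R (\<omega>' (z - x) \<xi> + \<omega>' \<xi> (z - x)))) (at z)" for z
    unfolding p_def by (auto intro!: derivative_eq_intros simp: )
  moreover have "(1/2) *\<^sub>R (\<omega>' (z - x) \<xi> + \<omega>' \<xi> (z - x)) = \<omega>' (z - x) \<xi>" for z \<xi>
    unfolding sym [of \<xi>] by (simp flip: scaleR_2)
  ultimately have p: "(p has_derivative \<alpha> z) (at z)" for z
    by (simp add: \<alpha>_def blinfun.add_left [abs_def])
  have affine: "segment_integral \<alpha> u v = p v - p u" for u v
    by (rule segment_integral_of_derivative) (rule p)
  have "norm (triangle_integral \<omega> a b c) \<le> \<epsilon> * (perimeter a b c)\<^sup>2"
    if x: "x \<in> convex hull {a, b, c}" and small: "perimeter a b c < d"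
      and cont: "continuous_on (convex hull {a, b, c}) \<omega>" for a b c
  proof -
    have side: "norm (segment_integral \<omega> u v - segment_integral \<alpha> u v)
        \<le> \<epsilon> * perimeter a b c * dist u v"
      if "u \<in> {a, b, c}" "v \<in> {a, b, c}" for u v
    proof -
      have uv: "closed_segment u v \<subseteq> convex hull {a, b, c}"
        using that by (simp add: closed_segment_subset convex_convex_hull hull_inc)
      have "continuous_on (closed_segment u v) \<omega>"
        using cont uv by (rule continuous_on_subset)
      moreover have "norm (\<omega> z - \<alpha> z) \<le> \<epsilon> * perimeter a b c" if "z \<in> closed_segment u v" for z
      proof -
        have "norm (z - x) \<le> perimeter a b c"
          using dist_le_perimeter x uv that by (metis dist_norm subsetD)
        moreover from this have "norm (\<omega> z - \<alpha> z) \<le> \<epsilon> * norm (z - x)"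
          using d [of z] small by (simp add: \<alpha>_def algebra_simps)
        ultimately show ?thesis
          using \<open>\<epsilon> > 0\<close> by (meson mult_left_mono order_less_imp_le order_trans)
      qed
      ultimately show ?thesis
        by (subst segment_integral_diff [symmetric])
          (auto intro!: norm_segment_integral_le continuous_intros \<alpha>_cont)
    qed
    have "triangle_integral \<omega> a b c
        = (segment_integral \<omega> a b - segment_integral \<alpha> a b)
        + (segment_integral \<omega> b c - segment_integral \<alpha> b c)
        + (segment_integral \<omega> c a - segment_integral \<alpha> c a)"
      by (simp add: triangle_integral_def affine)
    also have "norm \<dots> \<le> \<epsilon> * perimeter a b c * dist a b + \<epsilon> * perimeter a b c * dist b c
        + \<epsilon> * perimeter a b c * dist c a"
      by (intro norm_triangle_mono side) auto
    also have "\<dots> = \<epsilon> * (perimeter a b c)\<^sup>2"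
      by (simp add: perimeter_def power2_eq_square algebra_simps)
    finally show ?thesis .
  qed
  with \<open>d > 0\<close> show thesis by (rule that)
qed

text \<open>
  Three corner triangles and the medial triangle. The vertices are listed so that each side of
  the medial triangle is traversed in the direction opposite to that in the adjacent corner
  triangle; hence the interior sides cancel when the four boundary integrals are added.
\<close>

definition medial_pieces :: "'a::real_normed_vector \<times> 'a \<times> 'a \<Rightarrow> ('a \<times> 'a \<times> 'a) set" where
  "medial_pieces = (\<lambda>(a, b, c).
     {(a, midpoint a b, midpoint c a), (midpoint a b, b, midpoint b c),
      (midpoint c a, midpoint b c, c), (midpoint b c, midpoint c a, midpoint a b)})"

lemma medial_piece_subset:
  assumes "(a', b', c') \<in> medial_pieces (a, b, c)"
  shows "convex hull {a', b', c'} \<subseteq> convex hull {a, b, c}"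
proof (rule hull_minimal)
  have "u \<in> convex hull {a, b, c}" if "u \<in> {a, b, c}" for u
    using that by (rule hull_inc)
  moreover from this have "midpoint u v \<in> convex hull {a, b, c}"
    if "u \<in> {a, b, c}" "v \<in> {a, b, c}" for u v
    using that by (intro midpoints_in_convex_hull)
  ultimately show "{a', b', c'} \<subseteq> convex hull {a, b, c}"
    using assms unfolding medial_pieces_def by simp blast
qed (rule convex_convex_hull)

lemma dist_midpoint_midpoint:
  fixes u v w :: "'a::real_normed_vector"
  shows "dist (midpoint u v) (midpoint w u) = dist v w / 2"
proof -
  have "midpoint u v - midpoint w u = (1/2) *\<^sub>R (v - w)"
    by (simp add: midpoint_def algebra_simps)
  then show ?thesis by (simp add: dist_norm [of "midpoint u v"] dist_norm [of v])
qed

lemma perimeter_medial_piece: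
  assumes "(a', b', c') \<in> medial_pieces (a, b, c)"
  shows "perimeter a' b' c' = perimeter a b c / 2"
  using assms dist_midpoint_midpoint [of a b c] dist_midpoint_midpoint [of b c a]
    dist_midpoint_midpoint [of c a b]
  by (auto simp: medial_pieces_def perimeter_def dist_midpoint dist_commute)

lemma triangle_integral_quadrisection:
  fixes \<omega> :: "'a::real_normed_vector \<Rightarrow> 'a \<Rightarrow>\<^sub>L 'b::banach"
  assumes cont: "continuous_on (convex hull {a, b, c}) \<omega>"
  shows "\<exists>(a', b', c') \<in> medial_pieces (a, b, c).
    norm (triangle_integral \<omega> a b c) \<le> 4 * norm (triangle_integral \<omega> a' b' c')"
proof -
  let ?I = "segment_integral \<omega>" and ?T = "triangle_integral \<omega>"
  have mid: "?I u v = ?I u (midpoint u v) + ?I (midpoint u v) v"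
    if "u \<in> {a, b, c}" "v \<in> {a, b, c}" for u v
    using that by (intro segment_integral_midpoint continuous_on_subset [OF cont])
      (simp add: closed_segment_subset convex_convex_hull hull_inc)
  have rev: "?I v u = - ?I u v" if "u \<in> convex hull {a, b, c}" "v \<in> convex hull {a, b, c}" for u v
    using that by (intro segment_integral_reverse continuous_on_subset [OF cont])
      (simp add: closed_segment_subset convex_convex_hull)
  have [simp]: "midpoint a b \<in> convex hull {a, b, c}" "midpoint b c \<in> convex hull {a, b, c}"
    "midpoint c a \<in> convex hull {a, b, c}"
    by (intro midpoints_in_convex_hull hull_inc; simp)+
  have "?T a b c = ?T a (midpoint a b) (midpoint c a) + ?T (midpoint a b) b (midpoint b c)
      + ?T (midpoint c a) (midpoint b c) c + ?T (midpoint b c) (midpoint c a) (midpoint a b)"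
    using rev [of "midpoint a b" "midpoint c a"] rev [of "midpoint b c" "midpoint c a"]
      rev [of "midpoint a b" "midpoint b c"]
    by (simp add: triangle_integral_def mid [of a b] mid [of b c] mid [of c a])
  also have "norm \<dots> \<le> norm (?T a (midpoint a b) (midpoint c a))
      + norm (?T (midpoint a b) b (midpoint b c))
      + norm (?T (midpoint c a) (midpoint b c) c)
      + norm (?T (midpoint b c) (midpoint c a) (midpoint a b))"
    by (intro norm_triangle_mono order_refl)
  finally show ?thesis
    unfolding medial_pieces_def by (auto simp only: prod.case bex_simps)
qed

text \<open>
  Goursat's argument. Were the integral nonzero, repeated quadrisection would give nested
  triangles on which it decreases at most like \<open>4\<^sup>-\<^sup>n\<close>, whereas at their common point the local estimate
  bounds it by \<open>\<epsilon>\<close> times the squared perimeter, which is of order \<open>\<epsilon> 4\<^sup>-\<^sup>n\<close>.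
\<close>

theorem triangle_integral_eq_0:
  fixes \<omega> :: "'a::{real_normed_vector, heine_borel} \<Rightarrow> 'a \<Rightarrow>\<^sub>L 'b::banach"
    and \<omega>' :: "'a \<Rightarrow> 'a \<Rightarrow> 'a \<Rightarrow>\<^sub>L 'b"
  assumes deriv: "\<And>x. x \<in> convex hull {a, b, c} \<Longrightarrow> (\<omega> has_derivative \<omega>' x) (at x)"
    and sym: "\<And>x \<xi> \<eta>. x \<in> convex hull {a, b, c} \<Longrightarrow> \<omega>' x \<xi> \<eta> = \<omega>' x \<eta> \<xi>"
  shows "triangle_integral \<omega> a b c = 0"
proof (rule ccontr)
  let ?T = "triangle_integral \<omega>" and ?S = "convex hull {a, b, c}"
  define N where "N = norm (?T a b c)"
  define p where "p = perimeter a b c"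
  assume "?T a b c \<noteq> 0"
  then have "N > 0" by (simp add: N_def)
  have cont: "continuous_on ?S \<omega>"
    using deriv by (meson continuous_at_imp_continuous_on has_derivative_continuous)
  define good where "good = (\<lambda>n (u, v, w). convex hull {u, v, w} \<subseteq> ?S \<and>
      perimeter u v w = p / 2 ^ n \<and> N \<le> 4 ^ n * norm (?T u v w))"
  define hull_of where "hull_of = (\<lambda>(u, v, w). convex hull {u, v, w :: 'a})"
  have "\<exists>\<tau>. \<forall>n. good n (\<tau> n) \<and> hull_of (\<tau> (Suc n)) \<subseteq> hull_of (\<tau> n)"
  proof (rule dependent_nat_choice)
    have "good 0 (a, b, c)"
      by (simp add: good_def p_def N_def)
    then show "\<exists>t. good 0 t" ..
    fix t n assume "good n t"
    obtain u v w where t: "t = (u, v, w)" by (cases t)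
    from \<open>good n t\<close> have uvw: "convex hull {u, v, w} \<subseteq> ?S" "perimeter u v w = p / 2 ^ n"
      "N \<le> 4 ^ n * norm (?T u v w)"
      by (auto simp: good_def t)
    obtain u' v' w' where piece: "(u', v', w') \<in> medial_pieces (u, v, w)"
      and large: "norm (?T u v w) \<le> 4 * norm (?T u' v' w')"
      using triangle_integral_quadrisection [OF continuous_on_subset [OF cont uvw(1)]] by blast
    have "N \<le> 4 ^ n * (4 * norm (?T u' v' w'))"
      using uvw(3) mult_left_mono [OF large, of "4 ^ n"] by (meson order_trans zero_le_numeral zero_le_power)
    then have "good (Suc n) (u', v', w')"
      using medial_piece_subset [OF piece] perimeter_medial_piece [OF piece] uvw
      by (simp add: good_def mult_ac)
    moreover have "hull_of (u', v', w') \<subseteq> hull_of t"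
      using medial_piece_subset [OF piece] by (simp add: t hull_of_def)
    ultimately show "\<exists>t'. good (Suc n) t' \<and> hull_of t' \<subseteq> hull_of t" by blast
  qed
  then obtain \<tau> where \<tau>: "\<And>n. good n (\<tau> n)" "\<And>n. hull_of (\<tau> (Suc n)) \<subseteq> hull_of (\<tau> n)"
    by blast
  have "\<Inter> (range (hull_of \<circ> \<tau>)) \<noteq> {}"
  proof (rule compact_nest)
    show "compact ((hull_of \<circ> \<tau>) n)" "(hull_of \<circ> \<tau>) n \<noteq> {}" for n
      by (auto simp: hull_of_def split_beta finite_imp_compact_convex_hull)
    show "(hull_of \<circ> \<tau>) n \<subseteq> (hull_of \<circ> \<tau>) m" if "m \<le> n" for m n
      using lift_Suc_antimono_le [of "hull_of \<circ> \<tau>", OF _ that] \<tau>(2) by simp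
  qed
  then obtain x where x: "\<And>n. x \<in> hull_of (\<tau> n)" by auto
  have "x \<in> ?S"
    using x [of 0] \<tau>(1) [of 0] by (auto simp: hull_of_def good_def split_beta)
  \<comment> \<open>the summand 1 covers the degenerate case of perimeter 0\<close>
  define \<epsilon> where "\<epsilon> = N / (p\<^sup>2 + 1)"
  have "p\<^sup>2 + 1 > 0"
    by (simp add: add_nonneg_pos)
  then have "\<epsilon> > 0" "\<epsilon> * p\<^sup>2 < N"
    using \<open>N > 0\<close> by (auto simp: \<epsilon>_def field_simps)
  obtain d where "d > 0" and d: "\<And>u v w. \<lbrakk>x \<in> convex hull {u, v, w}; perimeter u v w < d;
      continuous_on (convex hull {u, v, w}) \<omega>\<rbrakk> \<Longrightarrow> norm (?T u v w) \<le> \<epsilon> * (perimeter u v w)\<^sup>2"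
    using triangle_integral_small [OF deriv [OF \<open>x \<in> ?S\<close>] sym [OF \<open>x \<in> ?S\<close>] \<open>\<epsilon> > 0\<close>] by blast
  obtain n where "p / d < 2 ^ n"
    using real_arch_pow [of 2 "p / d"] by auto
  then have "p / 2 ^ n < d"
    using \<open>d > 0\<close> by (simp add: field_simps)
  obtain u v w where uvw: "\<tau> n = (u, v, w)" by (cases "\<tau> n")
  have good: "convex hull {u, v, w} \<subseteq> ?S" "perimeter u v w = p / 2 ^ n"
    "N \<le> 4 ^ n * norm (?T u v w)"
    using \<tau>(1) [of n] by (auto simp: good_def uvw)
  have "norm (?T u v w) \<le> \<epsilon> * (p / 2 ^ n)\<^sup>2"
    using d [of u v w] x [of n] good \<open>p / 2 ^ n < d\<close> continuous_on_subset [OF cont good(1)]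
    by (simp add: hull_of_def uvw)
  then have "4 ^ n * norm (?T u v w) \<le> 4 ^ n * (\<epsilon> * (p / 2 ^ n)\<^sup>2)"
    by (intro mult_left_mono) auto
  also have "\<dots> = \<epsilon> * p\<^sup>2"
    by (simp add: power_divide power2_eq_square flip: power_mult_distrib)
  finally show False
    using good(3) \<open>\<epsilon> * p\<^sup>2 < N\<close> by linarith
qed

section \<open>Primitives of closed one-forms\<close>

text \<open>
  The increment of \<open>h\<close> differs from \<open>\<omega> x (y - x)\<close> by the integral of \<open>\<omega> - \<omega> x\<close> along a short segment,
  which continuity of \<open>\<omega>\<close> at \<open>x\<close> makes small relative to its length. This serves both to
  construct primitives and to differentiate a branch of \<open>H\<close>, which is given through its
  increments.
\<close>

lemma has_derivative_of_segment_integral: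
  fixes \<omega> :: "'a::real_normed_vector \<Rightarrow> 'a \<Rightarrow>\<^sub>L 'b::banach"
  assumes "open S" "x \<in> S" and cont: "continuous_on S \<omega>" and "convex S"
    and h: "\<And>y. y \<in> S \<Longrightarrow> h y - h x = segment_integral \<omega> x y"
  shows "(h has_derivative \<omega> x) (at x)"
  unfolding has_derivative_at_alt
proof (intro conjI allI impI)
  show "bounded_linear (\<omega> x)" by (rule blinfun.bounded_linear_right)
  fix \<epsilon> :: real assume "\<epsilon> > 0"
  have "isCont \<omega> x"
    using assms by (simp add: continuous_on_eq_continuous_at)
  then obtain d1 where d1: "d1 > 0" "\<And>z. dist z x < d1 \<Longrightarrow> dist (\<omega> z) (\<omega> x) < \<epsilon>"
    using \<open>\<epsilon> > 0\<close> unfolding continuous_at_eps_delta by blast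
  obtain d2 where d2: "d2 > 0" "ball x d2 \<subseteq> S"
    using \<open>open S\<close> \<open>x \<in> S\<close> open_contains_ball by blast
  have "norm (h y - h x - \<omega> x (y - x)) \<le> \<epsilon> * norm (y - x)" if y: "norm (y - x) < min d1 d2" for y
  proof -
    have "y \<in> S"
      using y d2 by (auto simp: dist_norm norm_minus_commute)
    have seg: "closed_segment x y \<subseteq> S"
      using \<open>convex S\<close> \<open>x \<in> S\<close> \<open>y \<in> S\<close> by (simp add: closed_segment_subset)
    have "closed_segment x y \<subseteq> ball x d1"
      using y d1(1) by (intro closed_segment_subset) (auto simp: dist_norm norm_minus_commute)
    then have near: "dist z x < d1" if "z \<in> closed_segment x y" for z
      using that by (auto simp: dist_commute)
    have const: "segment_integral (\<lambda>_. \<omega> x) x y = \<omega> x (y - x)"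
      by (simp add: segment_integral_def)
    have "h y - h x - \<omega> x (y - x) = segment_integral (\<lambda>z. \<omega> z - \<omega> x) x y"
      using h [OF \<open>y \<in> S\<close>] continuous_on_subset [OF cont seg]
      by (simp add: segment_integral_diff const)
    also have "norm \<dots> \<le> \<epsilon> * dist x y"
    proof (rule norm_segment_integral_le)
      show "continuous_on (closed_segment x y) (\<lambda>z. \<omega> z - \<omega> x)"
        using continuous_on_subset [OF cont seg] by (intro continuous_intros)
      show "norm (\<omega> z - \<omega> x) \<le> \<epsilon>" if "z \<in> closed_segment x y" for z
        using d1(2) [OF near [OF that]] by (simp add: dist_norm)
    qed
    finally show ?thesis by (simp add: dist_norm norm_minus_commute)
  qed
  then show "\<exists>d>0. \<forall>y. norm (y - x) < d \<longrightarrow> norm (h y - h x - \<omega> x (y - x)) \<le> \<epsilon> * norm (y - x)"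
    using d1(1) d2(1) by (intro exI [of _ "min d1 d2"]) auto
qed

text \<open>
  The Poincare lemma for one-forms that are differentiable, but not necessarily continuously so:
  integrating from a fixed point is a primitive because triangle integrals vanish.
\<close>

theorem closed_form_has_primitive:
  fixes \<omega> :: "'a::{real_normed_vector, heine_borel} \<Rightarrow> 'a \<Rightarrow>\<^sub>L 'b::banach"
    and \<omega>' :: "'a \<Rightarrow> 'a \<Rightarrow> 'a \<Rightarrow>\<^sub>L 'b"
  assumes "open S" "convex S"
    and deriv: "\<And>x. x \<in> S \<Longrightarrow> (\<omega> has_derivative \<omega>' x) (at x)"
    and sym: "\<And>x \<xi> \<eta>. x \<in> S \<Longrightarrow> \<omega>' x \<xi> \<eta> = \<omega>' x \<eta> \<xi>"
  obtains h where "\<And>x. x \<in> S \<Longrightarrow> (h has_derivative \<omega> x) (at x)"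
proof (cases "S = {}")
  case False
  then obtain x0 where "x0 \<in> S" by blast
  have cont: "continuous_on S \<omega>"
    using deriv by (meson continuous_at_imp_continuous_on has_derivative_continuous)
  have "(segment_integral \<omega> x0 has_derivative \<omega> x) (at x)" if "x \<in> S" for x
  proof (rule has_derivative_of_segment_integral [OF \<open>open S\<close> that cont \<open>convex S\<close>])
    fix y assume "y \<in> S"
    have hull: "convex hull {x0, x, y} \<subseteq> S"
      using \<open>x0 \<in> S\<close> \<open>x \<in> S\<close> \<open>y \<in> S\<close> \<open>convex S\<close> by (simp add: hull_minimal)
    then have "triangle_integral \<omega> x0 x y = 0"
      by (intro triangle_integral_eq_0) (use deriv sym in blast)+
    moreover have "segment_integral \<omega> y x0 = - segment_integral \<omega> x0 y"
      using \<open>x0 \<in> S\<close> \<open>y \<in> S\<close> \<open>convex S\<close>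
      by (intro segment_integral_reverse continuous_on_subset [OF cont]) (simp add: closed_segment_subset)
    ultimately show "segment_integral \<omega> x0 y - segment_integral \<omega> x0 x = segment_integral \<omega> x y"
      by (simp add: triangle_integral_def algebra_simps)
  qed
  then show thesis by (rule that)
qed (use that in blast)

section \<open>Units and inversion in the algebra\<close>

locale real_algebra3 =
  fixes m :: "real^3 \<Rightarrow> real^3 \<Rightarrow> real^3" and e :: "real^3"
  assumes algebra: "algebra_on_R3 m e"
begin

lemma assoc: "m (m a b) c = m a (m b c)"
  and comm: "m a b = m b a"
  and unit_left [simp]: "m e a = a"
  and unit_right [simp]: "m a e = a"
  using algebra unfolding algebra_on_R3_def by metis+

lemma left_comm: "m a (m b c) = m b (m a c)"
  by (metis assoc comm)

lemmas ac = assoc comm left_comm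

sublocale product: bounded_bilinear m
  using algebra unfolding algebra_on_R3_def bilinear_conv_bounded_bilinear by blast

lemma unit_nonzero: "e \<noteq> 0"
proof
  assume "e = 0"
  then have "a = 0" for a :: "real^3"
    using unit_left [of a] by (simp add: product.zero_left)
  then show False
    by (metis axis_eq_0_iff zero_neq_one)
qed

lemma alg_inv_eqI: "m a b = e \<Longrightarrow> alg_inv m e a = b"
  unfolding alg_inv_def by (rule the_equality) (metis assoc comm unit_left)+

lemma mult_alg_inv: "a \<in> alg_units m e \<Longrightarrow> m a (alg_inv m e a) = e"
  unfolding alg_units_def using alg_inv_eqI by auto

lemma alg_inv_mult_cancel: "a \<in> alg_units m e \<Longrightarrow> m (alg_inv m e a) (m a x) = x"
  by (metis assoc comm mult_alg_inv unit_left)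

text \<open>
  If \<open>y\<close> is close to the unit \<open>a\<close>, then multiplication by \<open>y\<close> is bounded below, hence
  injective, hence onto by finite dimension; the lower bound also controls the inverse.
\<close>

lemma units_near_unit:
  assumes a: "a \<in> alg_units m e"
  obtains d R where "d > 0" "R > 0"
    "\<And>y. norm (y - a) < d \<Longrightarrow> y \<in> alg_units m e \<and> norm (alg_inv m e y) \<le> R"
proof -
  define b where "b = alg_inv m e a"
  obtain K where K: "K > 0" "\<And>u v. norm (m u v) \<le> norm u * norm v * K"
    using product.pos_bounded by blast
  define C where "C = norm b * K + 1"
  have "C > 0" using K(1) by (simp add: C_def add_nonneg_pos)
  have mult_b: "norm (m b v) \<le> C * norm v" for v
  proof -
    have "norm (m b v) \<le> (norm b * K) * norm v" using K(2) [of b v] by (simp add: mult_ac)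
    also have "\<dots> \<le> C * norm v" by (intro mult_right_mono) (auto simp: C_def)
    finally show ?thesis .
  qed
  have below: "norm x \<le> 2 * C * norm (m y x)" if y: "norm (y - a) < 1 / (2 * C * K)" for x y
  proof -
    have "x = m b (m y x) - m b (m (y - a) x)"
      by (simp add: product.diff_left product.diff_right b_def alg_inv_mult_cancel [OF a])
    then have "norm x \<le> norm (m b (m y x)) + norm (m b (m (y - a) x))"
      by (metis norm_triangle_ineq4)
    also have "\<dots> \<le> C * norm (m y x) + C * (norm (y - a) * norm x * K)"
      using mult_b [of "m y x"] mult_b [of "m (y - a) x"] K(2) [of "y - a" x] \<open>C > 0\<close>
      by (smt (verit, best) mult_left_mono)
    also have "C * (norm (y - a) * norm x * K) = (C * K * norm (y - a)) * norm x"
      by simp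
    also have "\<dots> \<le> (1/2) * norm x"
      using y \<open>C > 0\<close> K(1) by (intro mult_right_mono) (auto simp: field_simps)
    finally show ?thesis by simp
  qed
  show thesis
  proof (rule that [of "1 / (2 * C * K)" "2 * C * norm e"])
    show "1 / (2 * C * K) > 0" "2 * C * norm e > 0"
      using \<open>C > 0\<close> K(1) unit_nonzero by auto
    fix y assume y: "norm (y - a) < 1 / (2 * C * K)"
    have lin: "linear (m y)"
      using product.bounded_linear_right bounded_linear.linear by blast
    have "inj (m y)"
      using below [OF y] unfolding linear_injective_0 [OF lin]
      by (metis mult_zero_right norm_le_zero_iff norm_zero)
    then have "surj (m y)"
      by (simp add: linear_injective_imp_surjective lin)
    then have unit: "y \<in> alg_units m e"
      unfolding alg_units_def by (metis (mono_tags, lifting) mem_Collect_eq surjD)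
    moreover have "norm (alg_inv m e y) \<le> 2 * C * norm e"
      using below [OF y, of "alg_inv m e y"] mult_alg_inv [OF unit] by simp
    ultimately show "y \<in> alg_units m e \<and> norm (alg_inv m e y) \<le> 2 * C * norm e" ..
  qed
qed

lemma open_alg_units: "open (alg_units m e)"
  unfolding open_dist
proof
  fix a assume "a \<in> alg_units m e"
  then obtain d R where "d > 0"
    "\<And>y. norm (y - a) < d \<Longrightarrow> y \<in> alg_units m e \<and> norm (alg_inv m e y) \<le> R"
    using units_near_unit by blast
  then show "\<exists>d>0. \<forall>y. dist y a < d \<longrightarrow> y \<in> alg_units m e"
    by (auto simp: dist_norm)
qed

text \<open>
  As for real numbers, the derivative of inversion at \<open>a\<close> is multiplication by \<open>- a\<^sup>-\<^sup>2\<close>. Two uses of the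
  resolvent identity bound the remainder by a multiple of \<open>\<bar>y - a\<bar>\<^sup>2\<close>.
\<close>

lemma alg_inv_has_derivative:
  assumes a: "a \<in> alg_units m e"
  shows "(alg_inv m e has_derivative (\<lambda>\<xi>. - m (m (alg_inv m e a) (alg_inv m e a)) \<xi>)) (at a)"
  unfolding has_derivative_at_alt
proof (intro conjI allI impI)
  let ?i = "alg_inv m e"
  define b where "b = ?i a"
  show "bounded_linear (\<lambda>\<xi>. - m (m b b) \<xi>)"
    by (intro bounded_linear_minus product.bounded_linear_right)
  obtain d R where d: "d > 0" "R > 0"
    "\<And>y. norm (y - a) < d \<Longrightarrow> y \<in> alg_units m e \<and> norm (?i y) \<le> R"
    using units_near_unit [OF a] by blast
  obtain K where K: "K > 0" "\<And>u v. norm (m u v) \<le> norm u * norm v * K"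
    using product.pos_bounded by blast
  define C where "C = norm b * K * K"
  have "C \<ge> 0" using K(1) by (simp add: C_def)
  have two: "norm (m b (m u v)) \<le> C * norm u * norm v" for u v
  proof -
    have "norm (m b (m u v)) \<le> norm b * norm (m u v) * K" by (rule K)
    also have "\<dots> \<le> norm b * (norm u * norm v * K) * K"
      using K by (intro mult_right_mono mult_left_mono) auto
    finally show ?thesis by (simp add: C_def mult_ac)
  qed
  fix \<epsilon> :: real assume "\<epsilon> > 0"
  define r where "r = min d (\<epsilon> / (C * C * R + 1))"
  have pos: "C * C * R + 1 > 0"
    using \<open>C \<ge> 0\<close> d(2) by (simp add: add_nonneg_pos)
  have "norm (?i y - b - - m (m b b) (y - a)) \<le> \<epsilon> * norm (y - a)" if y: "norm (y - a) < r" for y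
  proof -
    have unit: "y \<in> alg_units m e" and R: "norm (?i y) \<le> R"
      using d(3) [of y] y by (auto simp: r_def)
    \<comment> \<open>the resolvent identity: \<open>y\<^sup>-\<^sup>1 - a\<^sup>-\<^sup>1 = - a\<^sup>-\<^sup>1 (y - a) y\<^sup>-\<^sup>1\<close>\<close>
    have diff: "?i y - b = - m b (m (y - a) (?i y))"
      using mult_alg_inv [OF unit] alg_inv_mult_cancel [OF a, of "?i y"]
      by (simp add: product.diff_left product.diff_right b_def)
    have "m (m b b) (y - a) = m b (m (y - a) b)"
      by (simp only: ac)
    then have "?i y - b - - m (m b b) (y - a) = m b (m (y - a) b) - m b (m (y - a) (?i y))"
      by (simp only: diff) simp
    also have "\<dots> = - m b (m (y - a) (?i y - b))"
      by (simp only: product.diff_right [of _ "?i y" b] product.diff_right [of b "m (y - a) (?i y)"]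
          minus_diff_eq)
    also have "norm \<dots> \<le> C * norm (y - a) * norm (?i y - b)"
      using two by simp
    also have "\<dots> \<le> C * norm (y - a) * (C * norm (y - a) * norm (?i y))"
      unfolding diff using two \<open>C \<ge> 0\<close> by (intro mult_left_mono) auto
    also have "\<dots> \<le> C * norm (y - a) * (C * norm (y - a) * R)"
      using R \<open>C \<ge> 0\<close> by (intro mult_left_mono) auto
    also have "\<dots> = (C * C * R * norm (y - a)) * norm (y - a)"
      by simp
    also have "\<dots> \<le> \<epsilon> * norm (y - a)"
    proof (rule mult_right_mono)
      have "C * C * R * norm (y - a) \<le> (C * C * R + 1) * norm (y - a)"
        by (intro mult_right_mono) auto
      also have "\<dots> \<le> (C * C * R + 1) * (\<epsilon> / (C * C * R + 1))"
        using y pos by (intro mult_left_mono) (auto simp: r_def)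
      finally show "C * C * R * norm (y - a) \<le> \<epsilon>"
        using pos by simp
    qed simp
    finally show ?thesis .
  qed
  then show "\<exists>d>0. \<forall>y. norm (y - a) < d \<longrightarrow>
      norm (?i y - ?i a - - m (m (?i a) (?i a)) (y - a)) \<le> \<epsilon> * norm (y - a)"
    using d(1) \<open>\<epsilon> > 0\<close> pos unfolding b_def [symmetric] r_def by (intro exI [of _ r]) (auto simp: r_def)
qed

text \<open>
  Packaged as an operator, so that multiplication by an algebra-valued function is a one-form.
\<close>

definition mult_op :: "real^3 \<Rightarrow> (real^3) \<Rightarrow>\<^sub>L (real^3)" where
  "mult_op a = Blinfun (m a)"

lemma mult_op_apply [simp]: "mult_op a u = m a u"
  by (simp add: mult_op_def bounded_linear_Blinfun_apply product.bounded_linear_right)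

lemma bounded_linear_mult_op: "bounded_linear mult_op"
  unfolding linear_conv_bounded_linear [symmetric]
  by (rule linearI; rule blinfun_eqI)
    (simp_all add: product.add_left product.scaleR_left blinfun.add_left blinfun.scaleR_left)

end

section \<open>The branches of H\<close>

locale algebrizable_field = real_algebra3 m e
  for m :: "real^3 \<Rightarrow> real^3 \<Rightarrow> real^3" and e :: "real^3" +
  fixes \<Omega> :: "(real^3) set" and F F' :: "real^3 \<Rightarrow> real^3"
  assumes open_domain: "open \<Omega>"
    and F_derivative: "w \<in> \<Omega> \<Longrightarrow> (F has_derivative m (F' w)) (at w)"
begin

abbreviation D :: "(real^3) set" where "D \<equiv> regular_domain m e \<Omega> F"

definition recip :: "real^3 \<Rightarrow> real^3" where "recip w = alg_inv m e (F w)"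

text \<open>The derivative of \<open>e/F\<close> in the sense of the algebra, by the quotient rule.\<close>

definition recip' :: "real^3 \<Rightarrow> real^3" where "recip' w = - m (m (recip w) (recip w)) (F' w)"

lemma mult_recip_F: "w \<in> D \<Longrightarrow> m (recip w) (F w) = e"
  unfolding regular_domain_def recip_def using mult_alg_inv comm by auto

lemma recip_derivative:
  assumes "w \<in> D"
  shows "(recip has_derivative m (recip' w)) (at w)"
proof -
  have "(F has_derivative m (F' w)) (at w)" "F w \<in> alg_units m e"
    using assms F_derivative by (auto simp: regular_domain_def)
  then have "(alg_inv m e \<circ> F has_derivative
      (\<lambda>\<xi>. - m (m (recip w) (recip w)) \<xi>) \<circ> m (F' w)) (at w)"
    unfolding recip_def by (intro diff_chain_at alg_inv_has_derivative)
  moreover have "(\<lambda>\<xi>. - m (m (recip w) (recip w)) \<xi>) \<circ> m (F' w) = m (recip' w)"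
    by (simp add: fun_eq_iff recip'_def product.minus_left assoc)
  ultimately show ?thesis
    by (simp add: recip_def [abs_def] o_def)
qed

lemma continuous_on_recip: "continuous_on D recip"
  using recip_derivative by (meson continuous_at_imp_continuous_on has_derivative_continuous)

lemma open_D: "open D"
proof -
  have "continuous_on \<Omega> F"
    using F_derivative by (meson continuous_at_imp_continuous_on has_derivative_continuous)
  then have "open (\<Omega> \<inter> F -` alg_units m e)"
    using open_domain open_alg_units by (rule continuous_open_preimage)
  moreover have "D = \<Omega> \<inter> F -` alg_units m e"
    by (auto simp: regular_domain_def)
  ultimately show ?thesis by simp
qed

abbreviation form :: "real^3 \<Rightarrow> (real^3) \<Rightarrow>\<^sub>L (real^3)" where
  "form w \<equiv> mult_op (recip w)"

lemma form_derivative: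
  assumes "w \<in> D"
  shows "(form has_derivative (\<lambda>\<xi>. mult_op (m (recip' w) \<xi>))) (at w)"
  using bounded_linear.has_derivative [OF bounded_linear_mult_op recip_derivative [OF assms]] .

lemma continuous_on_form: "continuous_on D form"
  using form_derivative by (meson continuous_at_imp_continuous_on has_derivative_continuous)

text \<open>
  The derivative of the form \<open>\<xi> \<mapsto> (e/F) \<xi>\<close> is the bilinear map \<open>(\<xi>, \<eta>) \<mapsto> (e/F)' \<xi> \<eta>\<close>, which is symmetric
  because the algebra is commutative and associative.
\<close>

lemma form_has_primitive:
  assumes "ball w r \<subseteq> D"
  obtains h where "\<And>y. y \<in> ball w r \<Longrightarrow> (h has_derivative m (recip y)) (at y)"
proof -
  obtain h where h: "\<And>y. y \<in> ball w r \<Longrightarrow> (h has_derivative form y) (at y)"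
  proof (rule closed_form_has_primitive)
    show "(form has_derivative (\<lambda>\<xi>. mult_op (m (recip' y) \<xi>))) (at y)" if "y \<in> ball w r" for y
      using that assms by (intro form_derivative) auto
    show "mult_op (m (recip' y) \<xi>) \<eta> = mult_op (m (recip' y) \<eta>) \<xi>" for y \<xi> \<eta>
      by (simp add: ac)
  qed auto
  show thesis
  proof (rule that)
    fix y assume "y \<in> ball w r"
    then have "(h has_derivative form y) (at y)" by (rule h)
    moreover have "blinfun_apply (form y) = m (recip y)"
      by (simp add: fun_eq_iff)
    ultimately show "(h has_derivative m (recip y)) (at y)" by simp
  qed
qed

lemma has_integral_along_curve:
  assumes "U \<subseteq> D" and h: "\<And>y. y \<in> U \<Longrightarrow> (h has_derivative m (recip y)) (at y)"
    and curve: "curve_in U a \<gamma>"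
  shows "((\<lambda>t. m (recip (\<gamma> t)) (vector_derivative \<gamma> (at t within {0..a})))
    has_integral h (\<gamma> a) - h (\<gamma> 0)) {0..a}"
proof -
  have "0 \<le> a" and \<gamma>U: "\<And>t. t \<in> {0..a} \<Longrightarrow> \<gamma> t \<in> U" and \<gamma>_cont: "continuous_on {0..a} \<gamma>"
    using curve by (auto simp: curve_in_def piecewise_C1_differentiable_on_def)
  obtain S d where "finite S"
    and d: "\<And>t. t \<in> {0..a} - S \<Longrightarrow> (\<gamma> has_vector_derivative d t) (at t)"
    using curve unfolding curve_in_def piecewise_C1_differentiable_on_def C1_differentiable_on_def
    by blast
  have "((\<lambda>t. m (recip (\<gamma> t)) (vector_derivative \<gamma> (at t within {0..a})))
    has_integral (h \<circ> \<gamma>) a - (h \<circ> \<gamma>) 0) {0..a}"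
  proof (rule fundamental_theorem_of_calculus_interior_strong [OF \<open>finite S\<close> \<open>0 \<le> a\<close>])
    fix t assume t: "t \<in> {0<..<a} - S"
    then have dt: "(\<gamma> has_vector_derivative d t) (at t)"
      by (intro d) auto
    then have "vector_derivative \<gamma> (at t within {0..a}) = d t"
      using t by (intro vector_derivative_at_within_ivl) auto
    moreover have "(h has_derivative m (recip (\<gamma> t))) (at (\<gamma> t))"
      using t by (intro h \<gamma>U) auto
    ultimately show "(h \<circ> \<gamma> has_vector_derivative
        m (recip (\<gamma> t)) (vector_derivative \<gamma> (at t within {0..a}))) (at t)"
      using vector_derivative_diff_chain_within [OF dt] has_derivative_at_withinI by fastforce
  next
    have "continuous_on U h"
      using h by (meson continuous_at_imp_continuous_on has_derivative_continuous)
    then show "continuous_on {0..a} (h \<circ> \<gamma>)"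
      using \<gamma>U \<gamma>_cont by (intro continuous_on_compose) (auto elim: continuous_on_subset)
  qed
  then show ?thesis by simp
qed

lemma curve_in_linepath:
  assumes "closed_segment x y \<subseteq> U"
  shows "curve_in U 1 (linepath x y)"
proof -
  have "linepath x y C1_differentiable_on {0..1}"
    unfolding C1_differentiable_on_def
    by (auto intro!: exI [of _ "\<lambda>_. y - x"] has_vector_derivative_linepath_within continuous_intros)
  then show ?thesis
    using assms by (auto simp: curve_in_def linepath_image_01 intro: C1_differentiable_imp_piecewise)
qed

lemma inv_line_integral_linepath:
  "inv_line_integral m e F 1 (linepath x y) = segment_integral form x y"
  unfolding inv_line_integral_def segment_integral_def
  by (rule integral_cong) (simp add: vector_derivative_linepath_within recip_def)

text \<open>
  Coherence along the segments issuing from \<open>w\<close> expresses the increments of a branch as segment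
  integrals of a continuous form.
\<close>

lemma branch_derivative:
  assumes branch: "H_branch m e \<Omega> F b U h" and "w \<in> U"
  shows "(h has_derivative m (recip w)) (at w)"
proof -
  have "open U" "U \<subseteq> D" and coherent:
    "\<And>a \<gamma>. curve_in U a \<gamma> \<Longrightarrow> h (\<gamma> a) = h (\<gamma> 0) + inv_line_integral m e F a \<gamma>"
    using branch by (auto simp: H_branch_def)
  obtain r where "r > 0" and r: "ball w r \<subseteq> U"
    using \<open>open U\<close> \<open>w \<in> U\<close> open_contains_ball by blast
  have "(h has_derivative form w) (at w)"
  proof (rule has_derivative_of_segment_integral)
    show "open (ball w r)" "w \<in> ball w r" "convex (ball w r)"
      using \<open>r > 0\<close> by auto
    show "continuous_on (ball w r) form"
      using continuous_on_form r \<open>U \<subseteq> D\<close> by (blast intro: continuous_on_subset)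
    fix y assume "y \<in> ball w r"
    then have "closed_segment w y \<subseteq> U"
      using r \<open>r > 0\<close> by (meson centre_in_ball closed_segment_subset convex_ball order_trans)
    from coherent [OF curve_in_linepath [OF this]]
    show "h y - h w = segment_integral form w y"
      by (simp add: inv_line_integral_linepath linepath_0' linepath_1')
  qed
  moreover have "blinfun_apply (form w) = m (recip w)"
    by (simp add: fun_eq_iff)
  ultimately show ?thesis by simp
qed

text \<open>
  The base curve is extended by the segment from \<open>w\<close> to \<open>y\<close>; along that segment the integral
  is the increment of a local primitive.
\<close>

lemma line_integral_extended_curve:
  assumes ball: "ball w r \<subseteq> D" "y \<in> ball w r"
    and h: "\<And>y. y \<in> ball w r \<Longrightarrow> (h has_derivative m (recip y)) (at y)"
    and \<gamma>: "\<gamma> ` {0..1} \<subseteq> D" "\<gamma> 1 = w" "\<And>t. (\<gamma> has_vector_derivative d t) (at t)"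
      "continuous_on {0..1} d"
  defines "\<Gamma> \<equiv> \<lambda>t. if t \<le> 1 then \<gamma> t else linepath w y (t - 1)"
  shows "curve_in D 2 \<Gamma>"
    and "inv_line_integral m e F 2 \<Gamma> = integral {0..1} (\<lambda>t. m (recip (\<gamma> t)) (d t)) + (h y - h w)"
proof -
  have "w \<in> ball w r"
    using ball(2) by (metis centre_in_ball dist_not_less_zero mem_ball not_le order_le_less_trans zero_le_dist)
  then have seg: "closed_segment w y \<subseteq> ball w r"
    using ball(2) by (simp add: closed_segment_subset)
  have line: "((\<lambda>t. linepath w y (t - 1)) has_vector_derivative (y - w)) (at t)" for t
    unfolding linepath_def
    by (auto intro!: derivative_eq_intros simp: algebra_simps)
  have on_seg: "linepath w y (t - 1) \<in> ball w r" if "t \<in> {1..2}" for t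
    using seg that linepath_in_path [of "t - 1" w y] by auto
  show "curve_in D 2 \<Gamma>"
    unfolding curve_in_def
  proof (intro conjI)
    show "\<Gamma> piecewise_C1_differentiable_on {0..2}"
      unfolding \<Gamma>_def
    proof (rule piecewise_C1_differentiable_cases)
      show "\<gamma> piecewise_C1_differentiable_on {0..1}"
        using \<gamma>(3,4) by (intro C1_differentiable_imp_piecewise) (auto simp: C1_differentiable_on_def)
      show "(\<lambda>t. linepath w y (t - 1)) piecewise_C1_differentiable_on {1..2}"
        using line by (intro C1_differentiable_imp_piecewise)
          (auto simp: C1_differentiable_on_def intro!: exI [of _ "\<lambda>_. y - w"])
    qed (auto simp: \<gamma>(2) linepath_0')
    show "\<Gamma> ` {0..2} \<subseteq> D"
      using \<gamma>(1) on_seg ball(1) by (force simp: \<Gamma>_def)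
  qed simp
  let ?g = "\<lambda>t. m (recip (\<Gamma> t)) (vector_derivative \<Gamma> (at t within {0..2}))"
  have "\<Gamma> t = \<gamma> t" "vector_derivative \<Gamma> (at t within {0..2}) = d t" if "t \<in> {0..1} - {1}" for t
  proof -
    show "\<Gamma> t = \<gamma> t" using that by (simp add: \<Gamma>_def)
    have "(\<Gamma> has_vector_derivative d t) (at t)"
      by (rule has_vector_derivative_transform_within_open [OF \<gamma>(3), of "{..<1}"])
        (use that in \<open>auto simp: \<Gamma>_def\<close>)
    then show "vector_derivative \<Gamma> (at t within {0..2}) = d t"
      using that by (intro vector_derivative_at_within_ivl) auto
  qed
  moreover have "((\<lambda>t. m (recip (\<gamma> t)) (d t)) has_integral integral {0..1} (\<lambda>t. m (recip (\<gamma> t)) (d t))) {0..1}"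
  proof (intro integrable_integral integrable_continuous_real product.continuous_on \<gamma>(4))
    have "continuous_on {0..1} \<gamma>"
      using \<gamma>(3) by (meson continuous_at_imp_continuous_on has_vector_derivative_continuous)
    then show "continuous_on {0..1} (\<lambda>t. recip (\<gamma> t))"
      using continuous_on_compose2 [OF continuous_on_recip] \<gamma>(1) by blast
  qed
  ultimately have first: "(?g has_integral integral {0..1} (\<lambda>t. m (recip (\<gamma> t)) (d t))) {0..1}"
    by (intro has_integral_spike_finite [where S = "{1}" and g = ?g]) auto
  have "\<Gamma> t = linepath w y (t - 1)" "vector_derivative \<Gamma> (at t within {0..2}) = y - w"
    if "t \<in> {1..2} - {1}" for t
  proof -
    show "\<Gamma> t = linepath w y (t - 1)" using that by (simp add: \<Gamma>_def)
    have "(\<Gamma> has_vector_derivative y - w) (at t)"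
      by (rule has_vector_derivative_transform_within_open [OF line, of "{1<..}"])
        (use that in \<open>auto simp: \<Gamma>_def\<close>)
    then show "vector_derivative \<Gamma> (at t within {0..2}) = y - w"
      using that by (intro vector_derivative_at_within_ivl) auto
  qed
  moreover have "((\<lambda>t. m (recip (linepath w y (t - 1))) (y - w)) has_integral
      (h \<circ> (\<lambda>t. linepath w y (t - 1))) 2 - (h \<circ> (\<lambda>t. linepath w y (t - 1))) 1) {1..2}"
  proof (rule fundamental_theorem_of_calculus)
    fix t :: real assume "t \<in> {1..2}"
    then show "(h \<circ> (\<lambda>t. linepath w y (t - 1)) has_vector_derivative
        m (recip (linepath w y (t - 1))) (y - w)) (at t within {1..2})"
      by (intro vector_derivative_diff_chain_within [OF has_vector_derivative_at_within [OF line]]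
          has_derivative_at_withinI [OF h [OF on_seg]])
  qed simp
  ultimately have "(?g has_integral (h \<circ> (\<lambda>t. linepath w y (t - 1))) 2
      - (h \<circ> (\<lambda>t. linepath w y (t - 1))) 1) {1..2}"
    by (intro has_integral_spike_finite [where S = "{1}" and g = ?g]) auto
  then have "(?g has_integral h y - h w) {1..2}"
    by (simp add: linepath_def)
  with first have "(?g has_integral integral {0..1} (\<lambda>t. m (recip (\<gamma> t)) (d t)) + (h y - h w)) {0..2}"
    by (intro has_integral_combine [where c = 1]) auto
  then show "inv_line_integral m e F 2 \<Gamma> = integral {0..1} (\<lambda>t. m (recip (\<gamma> t)) (d t)) + (h y - h w)"
    unfolding inv_line_integral_def recip_def by (rule integral_unique)
qed

text \<open>
  Around \<open>w\<close>, join the base point to \<open>w\<close> once and continue along segments. The values so obtained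
  are a local primitive of the form, which makes them coherent along every curve. A polynomial
  curve serves as the joining curve because its velocity is continuous, so that the integral
  along it exists.
\<close>

lemma branch_exists:
  assumes base: "base_points D b" and "w \<in> D"
  obtains U h where "w \<in> U" "H_branch m e \<Omega> F b U h"
proof -
  obtain r where "r > 0" and r: "ball w r \<subseteq> D"
    using open_D \<open>w \<in> D\<close> open_contains_ball by blast
  obtain h0 where h0: "\<And>y. y \<in> ball w r \<Longrightarrow> (h0 has_derivative m (recip y)) (at y)"
    using form_has_primitive [OF r] by blast
  let ?C = "connected_component_set D w"
  have "open ?C" "connected ?C" "b w \<in> ?C" "w \<in> ?C"
    using open_D base \<open>w \<in> D\<close> by (auto simp: open_connected_component base_points_def)
  then obtain \<gamma> where \<gamma>: "polynomial_function \<gamma>" "path_image \<gamma> \<subseteq> ?C" "\<gamma> 0 = b w" "\<gamma> 1 = w"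
    using connected_open_polynomial_connected [of ?C "b w" w]
    unfolding pathstart_def pathfinish_def by blast
  then have \<gamma>D: "\<gamma> ` {0..1} \<subseteq> D"
    using connected_component_subset unfolding path_image_def by blast
  obtain d where d: "polynomial_function d" "\<And>t. (\<gamma> has_vector_derivative d t) (at t)"
    using has_vector_derivative_polynomial_function [OF \<gamma>(1)] by blast
  define h where "h y = integral {0..1} (\<lambda>t. m (recip (\<gamma> t)) (d t)) + (h0 y - h0 w)" for y
  have h: "(h has_derivative m (recip y)) (at y)" if "y \<in> ball w r" for y
    unfolding h_def using h0 [OF that] by (auto intro!: derivative_eq_intros)
  have "H_branch m e \<Omega> F b (ball w r) h"
    unfolding H_branch_def
  proof (intro conjI ballI allI impI)
    fix y assume y: "y \<in> ball w r"
    define \<Gamma> where "\<Gamma> t = (if t \<le> 1 then \<gamma> t else linepath w y (t - 1))" for t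
    have "curve_in D 2 \<Gamma>" "inv_line_integral m e F 2 \<Gamma> = h y"
      using line_integral_extended_curve [OF r y h0 \<gamma>D \<gamma>(4) d(2)]
        continuous_on_polymonial_function [OF d(1)]
      unfolding h_def \<Gamma>_def by blast+
    moreover have "b y = b w"
    proof -
      have "connected_component D w y"
        using y r \<open>r > 0\<close> by (intro connected_componentI [of "ball w r"]) auto
      then show ?thesis using base by (auto simp: base_points_def)
    qed
    ultimately show "h y \<in> H_values m e \<Omega> F b y"
      unfolding H_values_def
      by (intro CollectI exI [of _ 2] exI [of _ \<Gamma>]) (simp add: \<Gamma>_def \<gamma>(3) linepath_1')
  next
    fix a \<gamma> assume "curve_in (ball w r) a \<gamma>"
    from has_integral_along_curve [OF r h this]
    show "h (\<gamma> a) = h (\<gamma> 0) + inv_line_integral m e F a \<gamma>"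
      unfolding inv_line_integral_def recip_def by (simp add: integral_unique)
  qed (use r in auto)
  then show thesis
    using \<open>r > 0\<close> that by (meson centre_in_ball)
qed

text \<open>
  Every branch has derivative \<open>\<xi> \<mapsto> (e/F) \<xi>\<close>, so all branches pull the Euclidean metric back to the same
  form; that a branch exists at all makes the definite description refer to it.
\<close>

lemma H_pullback_metric_eq:
  assumes "base_points D b" and "w \<in> D"
  shows "H_pullback_metric m e \<Omega> F b w u v = m (recip w) u \<bullet> m (recip w) v"
  unfolding H_pullback_metric_def
proof (rule the_equality)
  have pullback: "pullback h euclidean_metric w u v = m (recip w) u \<bullet> m (recip w) v"
    if "H_branch m e \<Omega> F b U h" "w \<in> U" for U h
    using frechet_derivative_at [OF branch_derivative [OF that]]
    by (simp add: pullback_def euclidean_metric_def)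
  then show "\<exists>U h. w \<in> U \<and> H_branch m e \<Omega> F b U h \<and>
      m (recip w) u \<bullet> m (recip w) v = pullback h euclidean_metric w u v"
    using branch_exists [OF assms] by metis
  fix r assume "\<exists>U h. w \<in> U \<and> H_branch m e \<Omega> F b U h \<and> r = pullback h euclidean_metric w u v"
  then show "r = m (recip w) u \<bullet> m (recip w) v"
    using pullback by blast
qed

end

section \<open>The metric and its geodesics\<close>

lemma bounded_bilinear_coordinates:
  fixes B :: "real^'n \<Rightarrow> real^'n \<Rightarrow> 'a::real_normed_vector"
  assumes "bounded_bilinear B"
  shows "B u v = (\<Sum>i\<in>UNIV. \<Sum>j\<in>UNIV. (u $ i * v $ j) *\<^sub>R B (axis i 1) (axis j 1))"
proof -
  interpret bounded_bilinear B by fact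
  have "B u v = B (\<Sum>i\<in>UNIV. u $ i *\<^sub>R axis i 1) (\<Sum>j\<in>UNIV. v $ j *\<^sub>R axis j 1)"
    by (simp add: basis_expansion flip: scalar_mult_eq_scaleR)
  also have "\<dots> = (\<Sum>i\<in>UNIV. \<Sum>j\<in>UNIV. (u $ i * v $ j) *\<^sub>R B (axis i 1) (axis j 1))"
    unfolding sum_left unfolding sum_right by (simp add: scaleR_left scaleR_right mult.commute)
  finally show ?thesis .
qed

context algebrizable_field
begin

context
  fixes b :: "real^3 \<Rightarrow> real^3"
  assumes base: "base_points D b"
begin

definition g :: metric_field where
  "g w u v = 1 / (norm e)\<^sup>2 * H_pullback_metric m e \<Omega> F b w u v"

lemma g_eq: "w \<in> D \<Longrightarrow> g w u v = (m (recip w) u \<bullet> m (recip w) v) / (norm e)\<^sup>2"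
  by (simp add: g_def H_pullback_metric_eq [OF base])

lemma mult_recip_injective: "w \<in> D \<Longrightarrow> m (recip w) u = 0 \<Longrightarrow> u = 0"
  by (metis assoc comm mult_recip_F product.zero_right unit_left)

lemma bilinear_g: "w \<in> D \<Longrightarrow> bounded_bilinear (g w)"
proof -
  assume w: "w \<in> D"
  have "g w = (\<lambda>u v. (m (recip w) u /\<^sub>R (norm e)\<^sup>2) \<bullet> m (recip w) v)"
    using w by (simp add: fun_eq_iff g_eq divide_inverse mult.commute)
  moreover have "bounded_bilinear \<dots>"
    by (intro bounded_bilinear.comp [OF bounded_bilinear_inner] product.bounded_linear_right
        bounded_linear_compose [OF bounded_linear_scaleR_right product.bounded_linear_right])
  ultimately show ?thesis by simp
qed

lemma coeff_g_derivative:
  assumes "w \<in> D"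
  shows "(coeff g i j has_derivative (\<lambda>\<xi>.
      (m (m (recip' w) \<xi>) (axis i 1) \<bullet> m (recip w) (axis j 1) +
       m (recip w) (axis i 1) \<bullet> m (m (recip' w) \<xi>) (axis j 1)) / (norm e)\<^sup>2)) (at w)"
proof (rule has_derivative_transform_within_open [OF _ open_D assms])
  show "((\<lambda>w. (m (recip w) (axis i 1) \<bullet> m (recip w) (axis j 1)) / (norm e)\<^sup>2) has_derivative (\<lambda>\<xi>.
      (m (m (recip' w) \<xi>) (axis i 1) \<bullet> m (recip w) (axis j 1) +
       m (recip w) (axis i 1) \<bullet> m (m (recip' w) \<xi>) (axis j 1)) / (norm e)\<^sup>2)) (at w)"
    unfolding add.commute [of "m (m (recip' w) _) _ \<bullet> _"]
    by (intro bounded_linear.has_derivative [OF bounded_linear_divide] has_derivative_inner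
        bounded_linear.has_derivative [OF product.bounded_linear_left] recip_derivative assms)
qed (simp add: coeff_def g_eq)

lemma partial_coeff_g:
  assumes "w \<in> D"
  shows "partial_coeff g l i j w =
    (m (m (recip' w) (axis l 1)) (axis i 1) \<bullet> m (recip w) (axis j 1) +
     m (recip w) (axis i 1) \<bullet> m (m (recip' w) (axis l 1)) (axis j 1)) / (norm e)\<^sup>2"
  unfolding partial_coeff_def
  by (simp flip: frechet_derivative_at [OF coeff_g_derivative [OF assms]])

lemma riemannian_metric_g: "riemannian_metric_on D g"
  unfolding riemannian_metric_on_def
proof (intro conjI ballI allI impI open_D)
  fix w u v assume "w \<in> D"
  then show "bilinear (g w)"
    using bilinear_g bilinear_conv_bounded_bilinear by blast
  show "g w u v = g w v u"
    using \<open>w \<in> D\<close> by (simp add: g_eq inner_commute)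
  show "g w u u > 0" if "u \<noteq> 0"
  proof -
    have "m (recip w) u \<noteq> 0"
      using that mult_recip_injective [OF \<open>w \<in> D\<close>] by blast
    then show ?thesis
      using unit_nonzero by (simp add: g_eq [OF \<open>w \<in> D\<close>])
  qed
next
  fix i j show "coeff g i j differentiable_on D"
    unfolding differentiable_on_def
    using coeff_g_derivative by (meson differentiableI differentiable_at_withinI)
qed

lemma gram_mult_vec:
  assumes "w \<in> D"
  shows "((\<chi> p q. coeff g p q w) *v c) $ l = g w (axis l 1) c"
proof -
  have "c = (\<Sum>q\<in>UNIV. c $ q *\<^sub>R axis q 1)"
    by (simp add: basis_expansion flip: scalar_mult_eq_scaleR)
  then have "g w (axis l 1) c = (\<Sum>q\<in>UNIV. c $ q * g w (axis l 1) (axis q 1))"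
    using bounded_bilinear.sum_right [OF bilinear_g [OF assms]]
      bounded_bilinear.scaleR_right [OF bilinear_g [OF assms]]
    by (metis (mono_tags, lifting) real_scaleR_def sum.cong)
  then show ?thesis
    by (simp add: matrix_vector_mult_def coeff_def mult.commute)
qed

lemma gram_invertible:
  assumes "w \<in> D"
  shows "matrix_inv (\<chi> p q. coeff g p q w) ** (\<chi> p q. coeff g p q w) = mat 1"
proof -
  let ?G = "\<chi> p q. coeff g p q w"
  have "c = 0" if "?G *v c = 0" for c
  proof (rule ccontr)
    assume "c \<noteq> 0"
    have "g w c c = c \<bullet> (?G *v c)"
      using bounded_bilinear_coordinates [OF bilinear_g [OF assms], of c c]
      by (simp add: inner_vec_def matrix_vector_mult_def coeff_def sum_distrib_left mult_ac)
    also have "\<dots> = 0"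
      using that by simp
    finally show False
      using riemannian_metric_g \<open>c \<noteq> 0\<close> assms unfolding riemannian_metric_on_def
      by (metis less_irrefl)
  qed
  then have "invertible ?G"
    by (simp add: invertible_left_inverse matrix_left_invertible_ker)
  then show ?thesis
    unfolding invertible_def matrix_inv_def by (rule someI_ex [THEN conjunct2])
qed

text \<open>
  Up to the factor \<open>1/\<bar>e\<bar>\<^sup>2\<close>, differentiating the coefficients produces terms \<open>\<langle>(e/F)' e\<^sub>p e\<^sub>q, (e/F) e\<^sub>r\<rangle>\<close>, symmetric in \<open>p\<close> and \<open>q\<close>; in
  the combination defining the Christoffel symbols only \<open>2 \<langle>(e/F)' e\<^sub>i e\<^sub>j, (e/F) e\<^sub>l\<rangle>\<close> survives. Written as
  \<open>2 \<langle>(e/F) c, (e/F) e\<^sub>l\<rangle>\<close> with \<open>c = F (e/F)' e\<^sub>i e\<^sub>j\<close>, this is the Gram matrix applied to \<open>c\<close>, and the inverse Gram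
  matrix recovers \<open>c\<close>.
\<close>

lemma christoffel_g:
  assumes "w \<in> D"
  shows "christoffel g k i j w = m (F w) (m (m (recip' w) (axis i 1)) (axis j 1)) $ k"
proof -
  let ?G = "\<chi> p q. coeff g p q w"
  define c where "c = m (F w) (m (m (recip' w) (axis i 1)) (axis j 1))"
  have fc: "m (recip w) c = m (m (recip' w) (axis i 1)) (axis j 1)"
    unfolding c_def by (metis assms assoc mult_recip_F unit_left)
  have "partial_coeff g i j l w + partial_coeff g j i l w - partial_coeff g l i j w
      = 2 * (?G *v c) $ l" for l
  proof -
    have swap: "m (m (recip' w) (axis p 1)) (axis q 1) = m (m (recip' w) (axis q 1)) (axis p 1)" for p q
      by (simp only: ac)
    show ?thesis
      unfolding gram_mult_vec [OF assms] g_eq [OF assms] partial_coeff_g [OF assms] fc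
      by (simp add: swap [of j i] swap [of j l] swap [of i l] inner_commute
          add_divide_distrib diff_divide_distrib)
  qed
  then have "christoffel g k i j w = (matrix_inv ?G *v (?G *v c)) $ k"
    unfolding christoffel_def
    by (simp add: matrix_vector_mult_def [of "matrix_inv ?G"] sum_distrib_left)
  also have "matrix_inv ?G *v (?G *v c) = c"
    by (simp add: matrix_vector_mul_assoc gram_invertible [OF assms])
  finally show ?thesis by (simp add: c_def)
qed

text \<open>
  Along an integral curve the velocity is \<open>F\<close> and the acceleration is \<open>F' F\<close>, while the Christoffel
  term is \<open>F (e/F)' F F = F (- F'/F\<^sup>2) F\<^sup>2 = - F' F\<close>. The speed is \<open>\<bar>(e/F) F\<bar>/\<bar>e\<bar> = 1\<close>.
\<close>

lemma integral_curve_unit_speed_geodesic: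
  assumes "integral_curve F D I \<gamma>"
  shows "unit_speed_geodesic g I \<gamma>"
  unfolding unit_speed_geodesic_def
proof (intro exI ballI conjI allI)
  fix t assume "t \<in> I"
  then have w: "\<gamma> t \<in> D" and vel: "(\<gamma> has_vector_derivative F (\<gamma> t)) (at t)"
    using assms by (auto simp: integral_curve_def)
  show "(\<gamma> has_vector_derivative F (\<gamma> t)) (at t)" by fact
  have "(F has_derivative m (F' (\<gamma> t))) (at (\<gamma> t))"
    using w F_derivative by (auto simp: regular_domain_def)
  then show "((\<lambda>t. F (\<gamma> t)) has_vector_derivative m (F' (\<gamma> t)) (F (\<gamma> t))) (at t)"
    using vector_derivative_diff_chain_within [OF vel has_derivative_at_withinI] by (simp add: o_def)
  let ?F = "F (\<gamma> t)"
  show "g (\<gamma> t) ?F ?F = 1"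
    using w unit_nonzero by (simp add: g_eq mult_recip_F flip: power2_norm_eq_inner)
  fix k
  let ?B = "\<lambda>u v. m ?F (m (m (recip' (\<gamma> t)) u) v)"
  have "?B = (\<lambda>u v. m (m (m ?F (recip' (\<gamma> t))) u) v)"
    by (simp only: assoc)
  then have "bounded_bilinear ?B"
    using product.comp1 [OF product.bounded_linear_right] by simp
  from bounded_bilinear_coordinates [OF this, of ?F ?F]
  have "?B ?F ?F $ k = (\<Sum>i\<in>UNIV. \<Sum>j\<in>UNIV. christoffel g k i j (\<gamma> t) * ?F $ i * ?F $ j)"
    by (simp add: christoffel_g [OF w] mult_ac)
  moreover have "?B ?F ?F = - m (F' (\<gamma> t)) ?F"
  proof -
    have "?B ?F ?F = - m (m (recip (\<gamma> t)) ?F) (m (m (recip (\<gamma> t)) ?F) (m (F' (\<gamma> t)) ?F))"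
      unfolding recip'_def product.minus_left product.minus_right by (simp only: ac)
    then show ?thesis by (simp add: mult_recip_F [OF w])
  qed
  ultimately show "m (F' (\<gamma> t)) ?F $ k
      + (\<Sum>i\<in>UNIV. \<Sum>j\<in>UNIV. christoffel g k i j (\<gamma> t) * ?F $ i * ?F $ j) = 0"
    by simp
qed

end

end

theorem corollary3p2:
  fixes m :: "real^3 \<Rightarrow> real^3 \<Rightarrow> real^3" and e :: "real^3"
    and \<Omega> :: "(real^3) set" and F b :: "real^3 \<Rightarrow> real^3"
  assumes "algebra_on_R3 m e"
    and "open \<Omega>"
    and "algebrizable m \<Omega> F"
    and "base_points (regular_domain m e \<Omega> F) b"
  shows "makes_geodesible
           (\<lambda>w u v. 1 / (norm e)\<^sup>2 * H_pullback_metric m e \<Omega> F b w u v)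
           F (regular_domain m e \<Omega> F)"
proof -
  obtain F' where "\<And>w. w \<in> \<Omega> \<Longrightarrow> (F has_derivative m (F' w)) (at w)"
    using assms(3) unfolding algebrizable_def by auto
  then interpret algebrizable_field m e \<Omega> F F'
    using assms(1,2) by unfold_locales
  show ?thesis
    using riemannian_metric_g [OF assms(4)] integral_curve_unit_speed_geodesic [OF assms(4)]
    unfolding makes_geodesible_def g_def [OF assms(4), abs_def] by blast
qed

end
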